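(* For all $i,j\in I$: (a) $\mathcal Q_{ij}(u,v)\in\mathbb K_{ij}\{u,v\}$; (b) $\mathcal Q_{ii}(u,v)=0$; (c) $\mathcal Q_{ij}(u,v)=\mathcal Q_{ji}(v,u)$; (d) $\mathcal Q_{ij}(-u,v)=\mathcal Q_{ij}(u,v)$ whenever $i\in I_{\bar1}$. In particular, the entries of the matrix $\mathcal Q=(\mathcal Q_{ij}(u,v))_{i,j\in I}$ satisfy the properties that Kang, Kashiwara and Tsuchioka (in their paper introducing quiver Hecke superalgebras) require of a family of (skew-)polynomials, i.e. the conditions needed to construct the spin quiver Hecke algebra (in their terminology, quiver Hecke superalgebra) associated to $\mathcal Q$.
   Context: $\mathbb K$ is a field, $\operatorname{char}\mathbb K\ne2$. $\widetilde\Gamma$ is a finite quiver without loops with vertex set $\widetilde I$, (multi)set of edges $\widetilde H$, source and target maps $\mathrm{src},\mathrm{tgt}:\widetilde H\to\widetilde I$, and $a$ is an automorphism of $\widetilde\Gamma$ commuting with $\mathrm{src},\mathrm{tgt}$ such that no edge joins two vertices in the same $a$-orbit. $I$ is a set of representatives of the $a$-orbits on $\widetilde I$, and $\alpha_i$ is the orbit of $i\in I$. Put $s_i=|\alpha_i|$, $(\alpha_i,\alpha_i)=2s_i$, $(\alpha_i,\alpha_j)=-\#\{\text{edges joining a vertex of }\alpha_i\text{ to a vertex of }\alpha_j\}$ for $i\neq j$, and $a_{ij}=(\alpha_i,\alpha_j)/s_i$ for all $i,j\in I$. Assume $\gcd\{s_i\mid i\in I\}=1$. Put $p(i)=0$ (and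 $i\in I_{\bar0}$) if $s_i$ is even, $p(i)=1$ (and $i\in I_{\bar1}$) if $s_i$ is odd; so $I_{\bar1}\neq\emptyset$. Assume $a_{ij}\in2\mathbb Z$ for all $i\in I_{\bar1}$, $j\in I$. Let $d_{ij}$ be the number of $a$-orbits on $\{h\in\widetilde H:\mathrm{src}(h)\in\alpha_i,\ \mathrm{tgt}(h)\in\alpha_j\}$ and $m(i,j)=\mathrm{lcm}\{(\alpha_i,\alpha_i),(\alpha_j,\alpha_j)\}=2s_is_j/\gcd(s_i,s_j)$; it is part of the setting that $d_{ij}+d_{ji}=-2(\alpha_i,\alpha_j)/m(i,j)$ for $i\ne j$. Define the ring $\mathbb K_{ij}\{u,v\}=\mathbb K\langle u,v\rangle/\langle uv-(-1)^{p(i)p(j)}vu\rangle$. Set $\mathcal Q_{ii}(u,v)=0$ and, for $i\ne j$, $$\mathcal Q_{ij}(u,v)=(-1)^{d_{ij}}\big(u^{m(i,j)/(\alpha_i,\alpha_i)}-v^{m(i,j)/(\alpha_j,\alpha_j)}\big)^{-2(\alpha_i,\alpha_j)/m(i,j)} .$$ In (c), $\mathcal Q_{ji}(v,u)$ is the element of $\mathbb K_{ij}\{u,v\}$ obtained from $\mathcal Q_{ji}$ by substituting $v$ for its first and $u$ for its second variable. *)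

theory Defs
  imports
    "HOL-Combinatorics.Orbits"
    "HOL-Library.Poly_Mapping"
    "Graph_Theory.Digraph"
    "HOL-Algebra.QuotRing"
begin

section \<open>The free algebra on two generators and its skew quotients\<close>

text \<open>The free monoid on the letters \<open>u, v\<close>. It is written additively because
  \<^type>\<open>poly_mapping\<close> takes its convolution product over an additive (here
  non-commutative) monoid.\<close>

datatype letter = U_letter | V_letter

datatype ncword = Ncword (letters: "letter list")

instantiation ncword :: monoid_add
begin
definition zero_ncword :: ncword where "0 = Ncword []"
definition plus_ncword :: "ncword \<Rightarrow> ncword \<Rightarrow> ncword"
  where "w + w' = Ncword (letters w @ letters w')"
instance by standard (auto simp: zero_ncword_def plus_ncword_def)
end

type_synonym 'k free_alg2 = "ncword \<Rightarrow>\<^sub>0 'k"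

definition gen :: "letter \<Rightarrow> 'k::field free_alg2"
  where "gen x = Poly_Mapping.single (Ncword [x]) 1"

definition free_ring :: "'k::field free_alg2 ring"
  where "free_ring = \<lparr>carrier = UNIV, mult = (*), one = 1, zero = 0, add = (+)\<rparr>"

text \<open>The two-sided ideal generated by \<open>uv - (-1)\<^sup>e vu\<close>, and the quotient by it;
  \<open>\<bbbK>\<^sub>i\<^sub>j{u,v}\<close> is the case \<open>e = p(i) p(j)\<close>.\<close>

definition skew_ideal :: "nat \<Rightarrow> 'k::field free_alg2 set"
  where "skew_ideal e =
    Idl\<^bsub>free_ring\<^esub> {gen U_letter * gen V_letter - (- 1) ^ e * (gen V_letter * gen U_letter)}"

definition skew_ring :: "nat \<Rightarrow> 'k::field free_alg2 set ring"
  where "skew_ring e = free_ring Quot (skew_ideal e)"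

definition skew_class :: "nat \<Rightarrow> 'k::field free_alg2 \<Rightarrow> 'k free_alg2 set"
  where "skew_class e f = skew_ideal e +>\<^bsub>free_ring\<^esub> f"

text \<open>The \<open>\<bbbK>\<close>-algebra endomorphism of the free algebra with \<open>u \<mapsto> x\<close>, \<open>v \<mapsto> y\<close>.\<close>

definition free_subst ::
  "'k::field free_alg2 \<Rightarrow> 'k free_alg2 \<Rightarrow> 'k free_alg2 \<Rightarrow> 'k free_alg2"
  where "free_subst x y f = (\<Sum>w\<in>Poly_Mapping.keys f.
    Poly_Mapping.single 0 (Poly_Mapping.lookup f w) *
    prod_list (map (case_letter x y) (letters w)))"

text \<open>Substitution of the classes of \<open>x, y\<close> in the quotient with parameter \<open>e\<close> for the first and
  second variable of \<open>C\<close>, an element of a quotient with a possibly different parameter: all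
  representatives of \<open>C\<close> must give one and the same class (see \<open>skew_subst_class\<close> below).\<close>

definition skew_subst ::
  "nat \<Rightarrow> 'k::field free_alg2 \<Rightarrow> 'k free_alg2 \<Rightarrow> 'k free_alg2 set \<Rightarrow> 'k free_alg2 set"
  where "skew_subst e x y C = the_elem ((\<lambda>f. skew_class e (free_subst x y f)) ` C)"

subsection \<open>Substitution is well defined\<close>

lemma ring_free_ring: "ring (free_ring :: 'k::field free_alg2 ring)"
proof (rule ringI)
  show "abelian_group (free_ring :: 'k free_alg2 ring)"
  proof (rule abelian_groupI)
    fix x :: "'k free_alg2"
    show "\<exists>y\<in>carrier free_ring. y \<oplus>\<^bsub>free_ring\<^esub> x = \<zero>\<^bsub>free_ring\<^esub>"
      by (rule bexI[of _ "- x"]) (auto simp: free_ring_def)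
  qed (auto simp: free_ring_def algebra_simps)
  show "monoid (free_ring :: 'k free_alg2 ring)"
    by (rule monoidI) (auto simp: free_ring_def algebra_simps)
qed (auto simp: free_ring_def algebra_simps)

lemma ideal_free_ringI:
  fixes J :: "'k::field free_alg2 set"
  assumes "0 \<in> J" "\<And>f g. f \<in> J \<Longrightarrow> g \<in> J \<Longrightarrow> f + g \<in> J"
    and "\<And>f r. f \<in> J \<Longrightarrow> r * f \<in> J" "\<And>f r. f \<in> J \<Longrightarrow> f * r \<in> J"
  shows "ideal J free_ring"
proof (rule idealI[OF ring_free_ring])
  interpret ring "free_ring :: 'k free_alg2 ring" by (rule ring_free_ring)
  have neg: "\<ominus>\<^bsub>free_ring\<^esub> f = - f" for f :: "'k free_alg2"
    by (rule minus_equality) (auto simp: free_ring_def)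
  have "- f \<in> J" if "f \<in> J" for f
    using assms(3)[OF that, of "- 1"] by simp
  then show "subgroup J (add_monoid free_ring)"
    using assms neg by (intro add.subgroupI) (auto simp: free_ring_def a_inv_def)
qed (use assms in \<open>auto simp: free_ring_def\<close>)

lemma ideal_skew_ideal: "ideal (skew_ideal e :: 'k::field free_alg2 set) free_ring"
  unfolding skew_ideal_def
  by (rule ring.genideal_ideal[OF ring_free_ring]) (auto simp: free_ring_def)

lemma skew_ideal_closed:
  fixes f g :: "'k::field free_alg2"
  shows "0 \<in> (skew_ideal e :: 'k free_alg2 set)"
    and "f \<in> skew_ideal e \<Longrightarrow> g \<in> skew_ideal e \<Longrightarrow> f + g \<in> skew_ideal e"
    and "f \<in> skew_ideal e \<Longrightarrow> r * f \<in> skew_ideal e"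
    and "f \<in> skew_ideal e \<Longrightarrow> f * r \<in> skew_ideal e"
proof -
  interpret ideal "skew_ideal e :: 'k free_alg2 set" free_ring by (rule ideal_skew_ideal)
  show "0 \<in> (skew_ideal e :: 'k free_alg2 set)"
    using additive_subgroup.zero_closed[OF additive_subgroup_axioms] by (simp add: free_ring_def)
  show "f \<in> skew_ideal e \<Longrightarrow> g \<in> skew_ideal e \<Longrightarrow> f + g \<in> skew_ideal e"
    using additive_subgroup.a_closed[OF additive_subgroup_axioms, of f g] by (simp add: free_ring_def)
  show "f \<in> skew_ideal e \<Longrightarrow> r * f \<in> skew_ideal e"
    using I_l_closed[of f r] by (simp add: free_ring_def)
  show "f \<in> skew_ideal e \<Longrightarrow> f * r \<in> skew_ideal e"
    using I_r_closed[of f r] by (simp add: free_ring_def)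
qed

lemma skew_class_altdef: "skew_class e f = {h + f | h. h \<in> skew_ideal e}"
  by (auto simp: skew_class_def a_r_coset_def r_coset_def free_ring_def)

lemma skew_class_eq_iff: "skew_class e f = skew_class e g \<longleftrightarrow> f - g \<in> skew_ideal e"
proof
  assume "skew_class e f = skew_class e g"
  moreover have "f \<in> skew_class e f"
    using skew_ideal_closed(1) by (force simp: skew_class_altdef)
  ultimately show "f - g \<in> skew_ideal e" by (auto simp: skew_class_altdef)
next
  assume fg: "f - g \<in> skew_ideal e"
  then have gf: "g - f \<in> skew_ideal e" using skew_ideal_closed(3)[of "f - g" e "- 1"] by simp
  have "skew_class e f' \<subseteq> skew_class e g'" if "f' - g' \<in> skew_ideal e"
    for f' g' :: "'a free_alg2"
  proof
    fix x assume "x \<in> skew_class e f'"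
    then obtain h where "h \<in> skew_ideal e" "x = h + f'" by (auto simp: skew_class_altdef)
    then have "h + (f' - g') \<in> skew_ideal e" "x = (h + (f' - g')) + g'"
      using that by (auto intro: skew_ideal_closed(2))
    then show "x \<in> skew_class e g'" unfolding skew_class_altdef by blast
  qed
  from this[OF fg] this[OF gf] show "skew_class e f = skew_class e g" by blast
qed

lemma free_subst_superset:
  assumes "finite S" "Poly_Mapping.keys f \<subseteq> S"
  shows "free_subst x y f = (\<Sum>w\<in>S. Poly_Mapping.single 0 (Poly_Mapping.lookup f w) *
    prod_list (map (case_letter x y) (letters w)))"
  unfolding free_subst_def
  by (rule sum.mono_neutral_left) (use assms in \<open>auto simp: in_keys_iff\<close>)

lemma free_subst_add: "free_subst x y (f + g) = free_subst x y f + free_subst x y g"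
proof -
  let ?S = "Poly_Mapping.keys f \<union> Poly_Mapping.keys g"
  have "free_subst x y h = (\<Sum>w\<in>?S. Poly_Mapping.single 0 (Poly_Mapping.lookup h w) *
      prod_list (map (case_letter x y) (letters w)))" if "h \<in> {f, g, f + g}" for h
    by (rule free_subst_superset) (use that keys_add[of f g] in auto)
  then show ?thesis
    by (simp add: lookup_add single_add distrib_right sum.distrib)
qed

lemma free_subst_zero [simp]: "free_subst x y 0 = 0"
  by (simp add: free_subst_def)

lemma free_subst_sum: "free_subst x y (sum F S) = (\<Sum>s\<in>S. free_subst x y (F s))"
  by (induction S rule: infinite_finite_induct) (auto simp: free_subst_add)

lemma free_subst_single:
  "free_subst x y (Poly_Mapping.single w c) =
    Poly_Mapping.single 0 c * prod_list (map (case_letter x y) (letters w))"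
  by (subst free_subst_superset[of "{w}"]) auto

lemma single_zero_central:
  fixes f :: "'k::field free_alg2"
  shows "f * Poly_Mapping.single 0 c = Poly_Mapping.single 0 c * f"
proof (rule poly_mapping_eqI)
  fix w
  have *: "f = (\<Sum>w\<in>Poly_Mapping.keys f. Poly_Mapping.single w (Poly_Mapping.lookup f w))"
    by (rule poly_mapping_eqI)
      (auto simp: lookup_sum lookup_single when_def in_keys_iff sum.delta')
  show "Poly_Mapping.lookup (f * Poly_Mapping.single 0 c) w =
      Poly_Mapping.lookup (Poly_Mapping.single 0 c * f) w"
    by (subst (1 2) *) (simp add: sum_distrib_left sum_distrib_right mult_single mult.commute)
qed

lemma free_subst_mult:
  fixes f g :: "'k::field free_alg2"
  shows "free_subst x y (f * g) = free_subst x y f * free_subst x y g"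
proof -
  let ?s = "Poly_Mapping.single"
  let ?p = "\<lambda>w. prod_list (map (case_letter x y) (letters w))"
  have dec: "f = (\<Sum>w\<in>Poly_Mapping.keys f. ?s w (Poly_Mapping.lookup f w))"
    for f :: "'k free_alg2"
    by (rule poly_mapping_eqI)
      (auto simp: lookup_sum lookup_single when_def in_keys_iff sum.delta')
  have mono: "free_subst x y (?s w c * ?s w' c') = free_subst x y (?s w c) * free_subst x y (?s w' c')"
    for w w' c c'
  proof -
    have "free_subst x y (?s w c * ?s w' c') = ?s 0 (c * c') * (?p w * ?p w')"
      by (simp add: mult_single free_subst_single plus_ncword_def)
    also have "?s 0 (c * c') = (?s 0 c * ?s 0 c' :: 'k free_alg2)"
      by (simp add: mult_single)
    also have "\<dots> * (?p w * ?p w') = ?s 0 c * (?s 0 c' * ?p w) * ?p w'"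
      by (simp add: mult.assoc)
    also have "?s 0 c' * ?p w = ?p w * ?s 0 c'" by (rule single_zero_central[symmetric])
    finally show ?thesis by (simp add: free_subst_single mult.assoc)
  qed
  have "free_subst x y (f * g) = free_subst x y
      (\<Sum>w\<in>Poly_Mapping.keys f. \<Sum>w'\<in>Poly_Mapping.keys g.
        ?s w (Poly_Mapping.lookup f w) * ?s w' (Poly_Mapping.lookup g w'))"
    by (subst dec[of f], subst dec[of g]) (simp add: sum_product)
  also have "\<dots> = free_subst x y (\<Sum>w\<in>Poly_Mapping.keys f. ?s w (Poly_Mapping.lookup f w)) *
      free_subst x y (\<Sum>w\<in>Poly_Mapping.keys g. ?s w (Poly_Mapping.lookup g w))"
    by (simp add: free_subst_sum mono sum_product)
  finally show ?thesis by (simp flip: dec)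
qed

lemma free_subst_one [simp]: "free_subst x y 1 = 1"
proof -
  have "letters 0 = []" by (simp add: zero_ncword_def)
  then show ?thesis using free_subst_single[of x y 0 1] by simp
qed

lemma free_subst_gen [simp]:
  "free_subst x y (gen U_letter) = x" "free_subst x y (gen V_letter) = y"
  by (simp_all add: gen_def free_subst_single)

lemma free_subst_uminus: "free_subst x y (- f) = - free_subst x y f"
  using free_subst_add[of x y f "- f"] by (simp add: eq_neg_iff_add_eq_0 add.commute)

lemma free_subst_power: "free_subst x y (f ^ n) = free_subst x y f ^ n"
  by (induction n) (simp_all add: free_subst_mult)

text \<open>If \<open>x, y\<close> satisfy the defining relation of the source modulo the target ideal, substitution
  descends to the quotients.\<close>

lemma skew_subst_class:
  fixes f x y :: "'k::field free_alg2"
  assumes rel: "x * y - (- 1) ^ e' * (y * x) \<in> skew_ideal e"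
  shows "skew_subst e x y (skew_class e' f) = skew_class e (free_subst x y f)"
proof -
  let ?J = "{g. free_subst x y g \<in> skew_ideal e}"
  have "ideal ?J free_ring"
    by (rule ideal_free_ringI) (auto simp: free_subst_add free_subst_mult intro: skew_ideal_closed)
  moreover have "gen U_letter * gen V_letter - (- 1) ^ e' * (gen V_letter * gen U_letter) \<in> ?J"
    using rel
    by (simp add: free_subst_add free_subst_mult free_subst_uminus free_subst_power
        diff_conv_add_uminus del: add_uminus_conv_diff)
  ultimately have sub: "skew_ideal e' \<subseteq> ?J"
    unfolding skew_ideal_def by (intro ring.genideal_minimal[OF ring_free_ring]) auto
  have "(\<lambda>f. skew_class e (free_subst x y f)) ` skew_class e' f = {skew_class e (free_subst x y f)}"
  proof -
    have "skew_class e (free_subst x y g) = skew_class e (free_subst x y f)"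
      if g: "g \<in> skew_class e' f" for g
    proof -
      obtain h where h: "h \<in> skew_ideal e'" "g = h + f"
        using g by (auto simp: skew_class_altdef)
      show ?thesis
        unfolding skew_class_eq_iff using h sub by (auto simp: free_subst_add)
    qed
    moreover have "f \<in> skew_class e' f"
      using skew_ideal_closed(1) by (force simp: skew_class_altdef)
    ultimately show ?thesis by blast
  qed
  then show ?thesis by (simp add: skew_subst_def)
qed

lemma skew_subst_swap:
  "skew_subst e (gen V_letter) (gen U_letter) (skew_class e f) =
    skew_class e (free_subst (gen V_letter) (gen U_letter) (f :: 'k::field free_alg2))"
proof (rule skew_subst_class)
  let ?u = "gen U_letter :: 'k free_alg2" and ?v = "gen V_letter :: 'k free_alg2"
  have "?u * ?v - (- 1) ^ e * (?v * ?u) \<in> skew_ideal e"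
    unfolding skew_ideal_def
    by (rule ring.genideal_self'[OF ring_free_ring]) (simp add: free_ring_def)
  from skew_ideal_closed(3)[OF this, of "- ((- 1) ^ e)"]
  show "?v * ?u - (- 1) ^ e * (?u * ?v) \<in> skew_ideal e"
    by (cases "even e") (simp_all add: algebra_simps)
qed

lemma skew_subst_neg:
  "skew_subst e (- gen U_letter) (gen V_letter) (skew_class e f) =
    skew_class e (free_subst (- gen U_letter) (gen V_letter) (f :: 'k::field free_alg2))"
proof (rule skew_subst_class)
  let ?u = "gen U_letter :: 'k free_alg2" and ?v = "gen V_letter :: 'k free_alg2"
  have "?u * ?v - (- 1) ^ e * (?v * ?u) \<in> skew_ideal e"
    unfolding skew_ideal_def
    by (rule ring.genideal_self'[OF ring_free_ring]) (simp add: free_ring_def)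
  from skew_ideal_closed(3)[OF this, of "- 1"]
  show "- ?u * ?v - (- 1) ^ e * (?v * - ?u) \<in> skew_ideal e"
    by (simp add: algebra_simps)
qed

section \<open>Quivers with automorphism\<close>

text \<open>A quiver is a multidigraph, with \<^const>\<open>tail\<close> as source and \<^const>\<open>head\<close> as target;
  the automorphism \<open>a\<close> is given by its actions \<open>av\<close> on vertices and \<open>ae\<close> on edges.\<close>

definition quiver_automorphism :: "('v,'e) pre_digraph \<Rightarrow> ('v \<Rightarrow> 'v) \<Rightarrow> ('e \<Rightarrow> 'e) \<Rightarrow> bool"
  where "quiver_automorphism G av ae \<longleftrightarrow>
    bij_betw av (verts G) (verts G) \<and> bij_betw ae (arcs G) (arcs G) \<and>
    (\<forall>h\<in>arcs G. tail G (ae h) = av (tail G h) \<and> head G (ae h) = av (head G h))"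

definition orbit_representatives :: "('v,'e) pre_digraph \<Rightarrow> ('v \<Rightarrow> 'v) \<Rightarrow> 'v set \<Rightarrow> bool"
  where "orbit_representatives G av I \<longleftrightarrow>
    I \<subseteq> verts G \<and> (\<forall>x\<in>verts G. \<exists>!i. i \<in> I \<and> x \<in> orbit av i)"

definition orbit_size :: "('v \<Rightarrow> 'v) \<Rightarrow> 'v \<Rightarrow> nat"
  where "orbit_size av i = card (orbit av i)"

definition cform :: "('v,'e) pre_digraph \<Rightarrow> ('v \<Rightarrow> 'v) \<Rightarrow> 'v \<Rightarrow> 'v \<Rightarrow> int"
  where "cform G av i j =
    (if i = j then 2 * int (orbit_size av i)
     else - int (card {h \<in> arcs G.
       (tail G h \<in> orbit av i \<and> head G h \<in> orbit av j) \<or>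
       (tail G h \<in> orbit av j \<and> head G h \<in> orbit av i)}))"

definition cartan :: "('v,'e) pre_digraph \<Rightarrow> ('v \<Rightarrow> 'v) \<Rightarrow> 'v \<Rightarrow> 'v \<Rightarrow> rat"
  where "cartan G av i j = of_int (cform G av i j) / of_nat (orbit_size av i)"

definition parity :: "('v \<Rightarrow> 'v) \<Rightarrow> 'v \<Rightarrow> nat"
  where "parity av i = (if even (orbit_size av i) then 0 else 1)"

definition edge_orbits ::
  "('v,'e) pre_digraph \<Rightarrow> ('v \<Rightarrow> 'v) \<Rightarrow> ('e \<Rightarrow> 'e) \<Rightarrow> 'v \<Rightarrow> 'v \<Rightarrow> nat"
  where "edge_orbits G av ae i j =
    card (orbit ae ` {h \<in> arcs G. tail G h \<in> orbit av i \<and> head G h \<in> orbit av j})"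

definition lcm_form :: "('v,'e) pre_digraph \<Rightarrow> ('v \<Rightarrow> 'v) \<Rightarrow> 'v \<Rightarrow> 'v \<Rightarrow> int"
  where "lcm_form G av i j = lcm (cform G av i i) (cform G av j j)"

section \<open>The skew polynomials\<close>

text \<open>The exponents are integer quotients truncated to \<^typ>\<open>nat\<close>; they agree with the fractions
  written in the mathematical formula exactly when those are natural numbers, which is part of
  \<open>exponents_natural\<close>.\<close>

definition Qpoly ::
  "('v,'e) pre_digraph \<Rightarrow> ('v \<Rightarrow> 'v) \<Rightarrow> ('e \<Rightarrow> 'e) \<Rightarrow> 'v \<Rightarrow> 'v \<Rightarrow> 'k::field free_alg2 set"
  where "Qpoly G av ae i j =
    (let e = parity av i * parity av j;
         R = skew_ring e;
         u = skew_class e (gen U_letter);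
         v = skew_class e (gen V_letter);
         m = lcm_form G av i j
     in if i = j then \<zero>\<^bsub>R\<^esub>
        else (\<ominus>\<^bsub>R\<^esub> \<one>\<^bsub>R\<^esub>) [^]\<^bsub>R\<^esub> edge_orbits G av ae i j \<otimes>\<^bsub>R\<^esub>
          (u [^]\<^bsub>R\<^esub> nat (m div cform G av i i) \<ominus>\<^bsub>R\<^esub> v [^]\<^bsub>R\<^esub> nat (m div cform G av j j))
            [^]\<^bsub>R\<^esub> nat ((- 2 * cform G av i j) div m))"

definition exponents_natural :: "('v,'e) pre_digraph \<Rightarrow> ('v \<Rightarrow> 'v) \<Rightarrow> 'v \<Rightarrow> 'v \<Rightarrow> bool"
  where "exponents_natural G av i j \<longleftrightarrow>
    (of_int (lcm_form G av i j) / of_int (cform G av i i) :: rat) \<in> \<nat> \<and>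
    (of_int (lcm_form G av i j) / of_int (cform G av j j) :: rat) \<in> \<nat> \<and>
    (of_int (- 2 * cform G av i j) / of_int (lcm_form G av i j) :: rat) \<in> \<nat>"

text \<open>The conditions of Kang, Kashiwara and Tsuchioka on the family of skew polynomials defining a
  quiver Hecke superalgebra, for an index set \<open>I\<close> with parity function \<open>p\<close>.\<close>

definition KKT_family ::
  "'v set \<Rightarrow> ('v \<Rightarrow> nat) \<Rightarrow> ('v \<Rightarrow> 'v \<Rightarrow> 'k::field free_alg2 set) \<Rightarrow> bool"
  where "KKT_family I p Q \<longleftrightarrow> (\<forall>i\<in>I. \<forall>j\<in>I.
    Q i j \<in> carrier (skew_ring (p i * p j)) \<and>
    (i = j \<longrightarrow> Q i j = \<zero>\<^bsub>skew_ring (p i * p j)\<^esub>) \<and>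
    Q i j = skew_subst (p i * p j) (gen V_letter) (gen U_letter) (Q j i) \<and>
    (p i = 1 \<longrightarrow> skew_subst (p i * p j) (- gen U_letter) (gen V_letter) (Q i j) = Q i j))"

end

theory Submission
  imports Defs
begin

text \<open>Write \<open>s, t\<close> for the sizes of two distinct orbits and \<open>c\<close> for the number of edges
  between them. The orbit count says that the outer exponent \<open>N = c gcd(s,t) / (s t)\<close> equals
  \<open>d\<^sub>i\<^sub>j + d\<^sub>j\<^sub>i\<close>, so exchanging the two terms of the base costs exactly the sign
  \<open>(-1)\<close> to the power \<open>d\<^sub>i\<^sub>j + d\<^sub>j\<^sub>i\<close>; this is (c). For (d) let \<open>s\<close> be odd. If \<open>t\<close> is even then
  so is the exponent \<open>t / gcd(s,t)\<close> of \<open>u\<close>. If \<open>t\<close> is odd, both inner exponents are odd, so the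
  two terms \<open>x, y\<close> of the base anticommute and \<open>(x - y)\<^sup>2 = x\<^sup>2 + y\<^sup>2\<close> is insensitive to the sign
  of \<open>x\<close>; since \<open>c / s\<close> is even, so is \<open>N\<close>.\<close>

section \<open>Computing in the skew quotient\<close>

lemma free_subst_minus: "free_subst x y (f - g) = free_subst x y f - free_subst x y g"
  using free_subst_add[of x y f "- g"] by (simp add: free_subst_uminus)

lemma skew_class_hom:
  "skew_class e \<in> ring_hom (free_ring :: 'k::field free_alg2 ring) (skew_ring e)"
  using ideal.rcos_ring_hom[OF ideal_skew_ideal[of e]]
  by (simp add: skew_ring_def skew_class_def[abs_def])

lemma ring_skew_ring: "ring (skew_ring e :: 'k::field free_alg2 set ring)"
  unfolding skew_ring_def by (rule ideal.quotient_is_ring[OF ideal_skew_ideal])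

lemma skew_class_closed [simp]: "skew_class e f \<in> carrier (skew_ring e)"
  using ring_hom_closed[OF skew_class_hom, of f] by (simp add: free_ring_def)

lemma skew_class_mult: "skew_class e (f * g) = skew_class e f \<otimes>\<^bsub>skew_ring e\<^esub> skew_class e g"
  using ring_hom_mult[OF skew_class_hom, of f g] by (simp add: free_ring_def)

lemma skew_class_add: "skew_class e (f + g) = skew_class e f \<oplus>\<^bsub>skew_ring e\<^esub> skew_class e g"
  using ring_hom_add[OF skew_class_hom, of f g] by (simp add: free_ring_def)

lemma skew_class_one: "skew_class e 1 = \<one>\<^bsub>skew_ring e\<^esub>"
  using ring_hom_one[OF skew_class_hom] by (simp add: free_ring_def)

lemma skew_class_zero: "skew_class e 0 = \<zero>\<^bsub>skew_ring e\<^esub>"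
  using ring_hom_zero[OF skew_class_hom ring_free_ring ring_skew_ring] by (simp add: free_ring_def)

lemma skew_class_uminus:
  fixes f :: "'k::field free_alg2"
  shows "skew_class e (- f) = \<ominus>\<^bsub>skew_ring e\<^esub> skew_class e f"
proof -
  interpret R: ring "skew_ring e :: 'k free_alg2 set ring" by (rule ring_skew_ring)
  show ?thesis
    by (rule R.minus_equality[symmetric]) (simp_all flip: skew_class_add skew_class_zero)
qed

lemma skew_class_minus: "skew_class e (f - g) = skew_class e f \<ominus>\<^bsub>skew_ring e\<^esub> skew_class e g"
  using skew_class_add[of e f "- g"] by (simp add: skew_class_uminus a_minus_def)

lemma skew_class_power:
  fixes f :: "'k::field free_alg2"
  shows "skew_class e (f ^ n) = skew_class e f [^]\<^bsub>skew_ring e\<^esub> n"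
proof (induction n)
  case 0
  then show ?case by (simp add: skew_class_one)
next
  case (Suc n)
  have "skew_class e (f ^ Suc n) = skew_class e (f ^ n * f)" by (simp add: power_commutes)
  with Suc show ?case by (simp only: skew_class_mult nat_pow_Suc)
qed

lemmas skew_class_simps = skew_class_mult skew_class_add skew_class_minus skew_class_uminus
  skew_class_power skew_class_one skew_class_zero

lemma skew_class_relation:
  "skew_class e (gen U_letter * gen V_letter) =
    skew_class e ((- 1) ^ e * (gen V_letter * gen U_letter :: 'k::field free_alg2))"
  unfolding skew_class_eq_iff skew_ideal_def
  by (rule ring.genideal_self'[OF ring_free_ring]) (simp add: free_ring_def)

text \<open>Each factor \<open>f\<close> moved past \<open>g\<close> costs one sign, so
  \<open>k\<close> factors cost \<open>(- 1) ^ k\<close>, which is a single minus sign for odd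
  \<open>k\<close>.\<close>

lemma anticommute_power_left:
  fixes f g :: "'k::field free_alg2"
  assumes "skew_class e (f * g) = skew_class e (- (g * f))" and "odd n"
  shows "skew_class e (f ^ n * g) = skew_class e (- (g * f ^ n))"
proof -
  have "skew_class e (f ^ k * g) = skew_class e ((- 1) ^ k * (g * f ^ k))" for k
  proof (induction k)
    case (Suc k)
    have "skew_class e (f ^ Suc k * g) = skew_class e (f * (f ^ k * g))"
      by (simp add: mult.assoc)
    also have "\<dots> = skew_class e (f * ((- 1) ^ k * (g * f ^ k)))"
      by (simp only: skew_class_mult[of e f] Suc)
    also have "f * ((- 1) ^ k * (g * f ^ k)) = (- 1) ^ k * (f * g * f ^ k)"
      by (cases "even k") (simp_all add: mult.assoc)
    \<comment> \<open>The relation holds only modulo the ideal, so the class of \<open>f * g\<close>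
      has to be isolated as a factor before it can be replaced.\<close>
    also have "skew_class e \<dots> = skew_class e ((- 1) ^ k * (- (g * f) * f ^ k))"
      by (simp only: skew_class_mult[of e "(- 1) ^ k"] skew_class_mult[of e _ "f ^ k"] assms(1))
    also have "(- 1) ^ k * (- (g * f) * f ^ k) = (- 1) ^ Suc k * (g * f ^ Suc k)"
      by (simp add: mult.assoc)
    finally show ?case .
  qed simp
  from this[of n] \<open>odd n\<close> show ?thesis by simp
qed

lemma anticommute_sym:
  fixes f g :: "'k::field free_alg2"
  assumes "skew_class e (f * g) = skew_class e (- (g * f))"
  shows "skew_class e (g * f) = skew_class e (- (f * g))"
proof -
  have "skew_class e (- (f * g)) = skew_class e (- (- (g * f)))"
    by (simp only: skew_class_uminus[of e "f * g"] skew_class_uminus[of e "- (g * f)"] assms)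
  then show ?thesis by simp
qed

text \<open>The one-sided version is applied twice: first \<open>g\<close> is raised to the power
  \<open>n\<close>, then the relation is turned round and \<open>f\<close> is raised to the power
  \<open>m\<close>.\<close>

lemma anticommute_power:
  fixes f g :: "'k::field free_alg2"
  assumes "skew_class e (f * g) = skew_class e (- (g * f))" and "odd m" and "odd n"
  shows "skew_class e (f ^ m * g ^ n) = skew_class e (- (g ^ n * f ^ m))"
  using anticommute_power_left[OF
      anticommute_sym[OF anticommute_power_left[OF anticommute_sym[OF assms(1)] assms(3)]] assms(2)]
  by simp

lemma anticommute_even_power:
  fixes f g :: "'k::field free_alg2"
  assumes anti: "skew_class e (f * g) = skew_class e (- (g * f))" and "even n"
  shows "skew_class e ((- f - g) ^ n) = skew_class e ((f - g) ^ n)"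
proof -
  obtain k where k: "n = 2 * k" using \<open>even n\<close> by (auto elim: evenE)
  \<comment> \<open>In the free algebra the two squares differ by exactly twice
    \<open>f * g + g * f\<close>, the element that anticommutation puts into the ideal.\<close>
  have "(- f - g) ^ 2 - (f - g) ^ 2 = (f * g + g * f) + (f * g + g * f)"
    by (simp add: power2_eq_square algebra_simps)
  moreover have "f * g + g * f \<in> skew_ideal e"
    using anti by (simp add: skew_class_eq_iff)
  ultimately have "skew_class e ((- f - g) ^ 2) = skew_class e ((f - g) ^ 2)"
    by (simp add: skew_class_eq_iff skew_ideal_closed)
  then have "skew_class e (((- f - g) ^ 2) ^ k) = skew_class e (((f - g) ^ 2) ^ k)"
    by (simp only: skew_class_power[of e _ k])
  then show ?thesis by (simp add: k power_mult)
qed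

text \<open>For even \<open>m\<close> the two representatives already agree in the free algebra.
  Otherwise \<open>e\<close> is odd, the generators anticommute, and so do \<open>u^m\<close> and
  \<open>v^n\<close>; the sign of \<open>u^m\<close> then disappears in the even power.\<close>

lemma skew_class_neg_U:
  assumes "even m \<or> odd e \<and> odd m \<and> odd n \<and> even N"
  shows "skew_class e ((- 1) ^ d * ((- gen U_letter) ^ m - gen V_letter ^ n) ^ N) =
    skew_class e ((- 1) ^ d * (gen U_letter ^ m - gen V_letter ^ n) ^ N :: 'k::field free_alg2)"
  using assms
proof
  assume "odd e \<and> odd m \<and> odd n \<and> even N"
  moreover from this have "skew_class e (gen U_letter * gen V_letter) =
      skew_class e (- (gen V_letter * gen U_letter :: 'k free_alg2))"
    using skew_class_relation[of e] by simp
  ultimately show ?thesis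
    using anticommute_even_power[OF anticommute_power,
        of e "gen U_letter :: 'k free_alg2" "gen V_letter" m n N]
    by (simp add: skew_class_mult[of e "(- 1) ^ d"])
qed simp

section \<open>Exponents\<close>

text \<open>Gives an explicit representative in the free algebra, on which substitutions can be
  computed.\<close>

lemma Qpoly_offdiag:
  assumes "i \<noteq> j"
  shows "(Qpoly G av ae i j :: 'k::field free_alg2 set) =
    skew_class (parity av i * parity av j)
      ((- 1) ^ edge_orbits G av ae i j *
        (gen U_letter ^ nat (lcm_form G av i j div cform G av i i) -
         gen V_letter ^ nat (lcm_form G av i j div cform G av j j))
        ^ nat ((- 2 * cform G av i j) div lcm_form G av i j))"
  using assms by (simp add: Qpoly_def Let_def skew_class_simps)

lemma cform_commute: "cform G av i j = cform G av j i"
  unfolding cform_def by (auto intro!: arg_cong[of _ _ card])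

lemma lcm_form_commute: "lcm_form G av i j = lcm_form G av j i"
  by (simp add: lcm_form_def lcm.commute)

lemma orbit_size_pos:
  assumes "fin_digraph G" "quiver_automorphism G av ae" "orbit_representatives G av I" "i \<in> I"
  shows "orbit_size av i > 0"
proof -
  have verts: "av x \<in> verts G" if "x \<in> verts G" for x
    using assms(2) that by (auto simp: quiver_automorphism_def bij_betw_def)
  have i: "i \<in> verts G" using assms(3,4) by (auto simp: orbit_representatives_def)
  have "x \<in> verts G" if "x \<in> orbit av i" for x
    using that by induction (auto intro: verts i)
  then have "finite (orbit av i)"
    using fin_digraph.finite_verts[OF assms(1)] by (auto intro: finite_subset)
  \<comment> \<open>\<open>orbit\<close> is generated from \<open>av i\<close> rather than from
    \<open>i\<close>, so \<open>av i\<close> is the evident member.\<close>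
  moreover have "orbit av i \<noteq> {}" using orbit.base[of av i] by auto
  ultimately show ?thesis by (simp add: orbit_size_def card_gt_0_iff)
qed

lemma lcm_form_div:
  "lcm_form G av i j div cform G av i i = lcm (int (orbit_size av i)) (int (orbit_size av j))
    div int (orbit_size av i)"
proof -
  have "lcm (2 * int a) (2 * int b) = 2 * lcm (int a) (int b)" for a b
    using lcm_mult_left[of 2 "int a" "int b"] by simp
  then show ?thesis by (simp add: lcm_form_def cform_def)
qed

text \<open>The quotient is \<open>t div gcd s t\<close>, and \<open>gcd s t\<close> is odd as a
  divisor of \<open>s\<close>.\<close>

lemma odd_lcm_div:
  fixes s t :: int
  assumes "odd s" "s > 0" "t > 0"
  shows "odd (lcm s t div s) \<longleftrightarrow> odd t"
proof -
  have "lcm s t * gcd s t = s * t"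
    using assms lcm_gcd_prod[of s t] by (simp add: abs_of_pos)
  moreover have "lcm s t = s * (lcm s t div s)" by simp
  ultimately have "s * ((lcm s t div s) * gcd s t) = s * t" by (metis mult.assoc)
  then have "(lcm s t div s) * gcd s t = t" using assms by simp
  moreover have "odd (gcd s t)" using assms(1) by (meson dvd_trans gcd_dvd1)
  ultimately show ?thesis by (metis even_mult_iff)
qed

section \<open>Pairs of distinct orbits\<close>

locale quiver_data =
  fixes G :: "('v, 'e) pre_digraph" and av :: "'v \<Rightarrow> 'v" and ae :: "'e \<Rightarrow> 'e" and i j :: 'v
  assumes size_pos: "orbit_size av i > 0" "orbit_size av j > 0"
    and distinct: "i \<noteq> j"
    and orbit_count: "(of_nat (edge_orbits G av ae i j + edge_orbits G av ae j i) :: rat) =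
      of_int (- 2 * cform G av i j) / of_int (lcm_form G av i j)"
begin

lemma lcm_form_pos: "lcm_form G av i j > 0"
  using size_pos by (simp add: lcm_form_def cform_def lcm_pos_int)

text \<open>Clearing the denominator in \<open>orbit_count\<close> shows that the integer division
  in the outer exponent is exact.\<close>

lemma form_eq:
  "- 2 * cform G av i j =
    int (edge_orbits G av ae i j + edge_orbits G av ae j i) * lcm_form G av i j"
proof -
  have "(of_int (- 2 * cform G av i j) :: rat) =
      of_int (int (edge_orbits G av ae i j + edge_orbits G av ae j i) * lcm_form G av i j)"
    using orbit_count lcm_form_pos by (simp add: field_simps)
  then show ?thesis by (simp only: of_int_eq_iff)
qed

lemma outer_exponent:
  "nat ((- 2 * cform G av i j) div lcm_form G av i j) =
    edge_orbits G av ae i j + edge_orbits G av ae j i"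
  unfolding form_eq using lcm_form_pos by simp

lemma exponents_natural: "exponents_natural G av i j"
proof -
  have nat: "(of_int m / of_int k :: rat) \<in> \<nat>" if "k dvd m" "k > 0" "m > 0" for k m :: int
  proof -
    have "(of_int m / of_int k :: rat) = of_int (m div k)"
      using that(1) by (simp add: of_int_div)
    also have "\<dots> = of_nat (nat (m div k))" using that by (simp add: pos_imp_zdiv_nonneg_iff)
    finally show ?thesis by (simp only: of_nat_in_Nats)
  qed
  have "cform G av i i > 0" "cform G av j j > 0"
    using size_pos by (simp_all add: cform_def)
  moreover have "cform G av i i dvd lcm_form G av i j" "cform G av j j dvd lcm_form G av i j"
    by (simp_all add: lcm_form_def)
  moreover have "(of_int (- 2 * cform G av i j) / of_int (lcm_form G av i j) :: rat) \<in> \<nat>"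
    by (simp only: orbit_count[symmetric] of_nat_in_Nats)
  ultimately show ?thesis
    unfolding exponents_natural_def using nat lcm_form_pos by blast
qed

lemma Qpoly_swap:
  "(Qpoly G av ae i j :: 'k::field free_alg2 set) =
    skew_subst (parity av i * parity av j) (gen V_letter) (gen U_letter) (Qpoly G av ae j i)"
proof -
  let ?d = "edge_orbits G av ae i j" and ?d' = "edge_orbits G av ae j i"
  have sign: "(- 1) ^ ?d' * (y - x) ^ (?d + ?d') = (- 1) ^ ?d * (x - y) ^ (?d + ?d')"
    for x y :: "'k free_alg2"
  proof -
    have "(y - x) ^ (?d + ?d') = (- 1) ^ (?d + ?d') * (x - y) ^ (?d + ?d')"
      using power_minus[of "x - y" "?d + ?d'"] by simp
    \<comment> \<open>The exponents \<open>?d' + (?d + ?d')\<close> and \<open>?d\<close> of the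
      sign have the same parity.\<close>
    then show ?thesis
      by (cases "even ?d"; cases "even ?d'") simp_all
  qed
  show ?thesis
    using distinct
    by (simp add: Qpoly_offdiag mult.commute[of "parity av j"] cform_commute[of G av j i]
        lcm_form_commute[of G av j i] outer_exponent[simplified] skew_subst_swap free_subst_mult
        free_subst_power free_subst_minus free_subst_uminus add.commute[of ?d' ?d] sign)
qed

text \<open>An even Cartan entry makes the form value even. Up to sign that value is the outer
  exponent times the lcm of two odd orbit sizes, so the exponent carries the factor 2.\<close>

lemma even_outer_exponent:
  assumes "odd (orbit_size av i)" "odd (orbit_size av j)"
    and "cartan G av i j = of_int (2 * n)"
  shows "even (edge_orbits G av ae i j + edge_orbits G av ae j i)"
proof -
  let ?l = "lcm (int (orbit_size av i)) (int (orbit_size av j))"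
  have "(of_int (cform G av i j) :: rat) = of_int (2 * n * int (orbit_size av i))"
    using assms(3) size_pos by (simp add: cartan_def field_simps)
  then have "even (cform G av i j)" by (simp only: of_int_eq_iff) simp
  moreover have "lcm_form G av i j = 2 * ?l"
    using lcm_mult_left[of 2 "int (orbit_size av i)" "int (orbit_size av j)"]
    by (simp add: lcm_form_def cform_def)
  then have "2 * (- cform G av i j) =
      2 * (int (edge_orbits G av ae i j + edge_orbits G av ae j i) * ?l)"
    using form_eq by (simp only: mult.left_commute mult_minus_left mult_minus_right)
  then have "- cform G av i j = int (edge_orbits G av ae i j + edge_orbits G av ae j i) * ?l"
    by linarith
  moreover have "odd ?l"
  proof -
    have "?l dvd int (orbit_size av i) * int (orbit_size av j)"
      by (intro lcm_least) simp_all
    then show ?thesis using assms(1,2) by (metis dvd_trans even_mult_iff even_of_nat)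
  qed
  ultimately show ?thesis by (metis even_minus even_mult_iff even_of_nat)
qed

lemma Qpoly_neg:
  assumes "parity av i = 1" and "cartan G av i j = of_int (2 * n)"
  shows "skew_subst (parity av i * parity av j) (- gen U_letter) (gen V_letter) (Qpoly G av ae i j)
    = (Qpoly G av ae i j :: 'k::field free_alg2 set)"
proof -
  let ?m = "nat (lcm_form G av i j div cform G av i i)"
    and ?n = "nat (lcm_form G av i j div cform G av j j)"
  have odd_i: "odd (orbit_size av i)" using assms(1) by (auto simp: parity_def split: if_splits)
  \<comment> \<open>\<open>nat\<close> preserves parity only on nonnegative integers.\<close>
  have nonneg: "0 \<le> lcm_form G av i j div cform G av k k" for k
    using lcm_form_pos by (simp add: cform_def div_int_pos_iff)
  have m: "odd ?m \<longleftrightarrow> odd (orbit_size av j)"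
    using odd_lcm_div[of "int (orbit_size av i)" "int (orbit_size av j)"] odd_i size_pos
    by (subst even_nat_iff[OF nonneg]) (simp add: lcm_form_div)
  have "odd ?n" if "odd (orbit_size av j)"
    using odd_lcm_div[of "int (orbit_size av j)" "int (orbit_size av i)"] that odd_i size_pos
    by (subst even_nat_iff[OF nonneg]) (simp add: lcm_form_commute[of G av i j] lcm_form_div)
  \<comment> \<open>An even orbit of \<open>j\<close> gives the first alternative, an odd one the
    second; in the latter case both parities are 1.\<close>
  with m have "even ?m \<or> odd (parity av i * parity av j) \<and> odd ?m \<and> odd ?n \<and>
      even (edge_orbits G av ae i j + edge_orbits G av ae j i)"
    using even_outer_exponent[OF odd_i _ assms(2)] assms(1) by (auto simp: parity_def)
  from skew_class_neg_U[OF this, of "edge_orbits G av ae i j"] show ?thesis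
    using distinct
    by (simp add: Qpoly_offdiag outer_exponent[simplified] skew_subst_neg free_subst_mult
        free_subst_power free_subst_minus free_subst_uminus)
qed

end

section \<open>Diagonal entries and assembly\<close>

lemma Qpoly_diag: "Qpoly G av ae i i = \<zero>\<^bsub>skew_ring (parity av i * parity av i)\<^esub>"
  by (simp add: Qpoly_def Let_def)

lemma Qpoly_closed: "Qpoly G av ae i j \<in> carrier (skew_ring (parity av i * parity av j))"
  by (cases "i = j") (simp_all add: Qpoly_diag Qpoly_offdiag flip: skew_class_zero)

text \<open>Zero is the class of 0, which every substitution fixes; this covers the case
  \<open>i = j\<close>, which the locale excludes.\<close>

lemma Qpoly_diag_subst:
  "skew_subst (parity av i * parity av i) (gen V_letter) (gen U_letter) (Qpoly G av ae i i) =
    (Qpoly G av ae i i :: 'k::field free_alg2 set)"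
  "skew_subst (parity av i * parity av i) (- gen U_letter) (gen V_letter) (Qpoly G av ae i i) =
    (Qpoly G av ae i i :: 'k::field free_alg2 set)"
  by (simp_all add: Qpoly_diag skew_subst_swap skew_subst_neg flip: skew_class_zero)

theorem lemma2p1:
  fixes G :: "('v, 'e) pre_digraph" and av :: "'v \<Rightarrow> 'v" and ae :: "'e \<Rightarrow> 'e" and I :: "'v set"
    and Q :: "'v \<Rightarrow> 'v \<Rightarrow> 'k::field free_alg2 set"
  assumes char_K: "CHAR('k) \<noteq> 2"
    and finite_quiver: "fin_digraph G"
    and no_loops: "loopfree_digraph G"
    and automorphism: "quiver_automorphism G av ae"
    and no_edge_in_orbit: "\<forall>h\<in>arcs G. head G h \<notin> orbit av (tail G h)"
    and representatives: "orbit_representatives G av I"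
    and gcd_sizes: "Gcd (orbit_size av ` I) = 1"
    and odd_rows: "\<forall>i\<in>I. \<forall>j\<in>I. parity av i = 1 \<longrightarrow> (\<exists>n::int. cartan G av i j = of_int (2 * n))"
    and edge_orbit_count: "\<forall>i\<in>I. \<forall>j\<in>I. i \<noteq> j \<longrightarrow>
      (of_nat (edge_orbits G av ae i j + edge_orbits G av ae j i) :: rat) =
        of_int (- 2 * cform G av i j) / of_int (lcm_form G av i j)"
    and Q_def: "Q = Qpoly G av ae"
  shows "(\<forall>i\<in>I. \<forall>j\<in>I.
      ((i \<noteq> j \<longrightarrow> exponents_natural G av i j) \<and>
        Q i j \<in> carrier (skew_ring (parity av i * parity av j))) \<and>
      Q i i = \<zero>\<^bsub>skew_ring (parity av i * parity av i)\<^esub> \<and>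
      Q i j = skew_subst (parity av i * parity av j) (gen V_letter) (gen U_letter) (Q j i) \<and>
      (parity av i = 1 \<longrightarrow>
        skew_subst (parity av i * parity av j) (- gen U_letter) (gen V_letter) (Q i j) = Q i j)) \<and>
    KKT_family I (parity av) Q"
proof -
  have data: "quiver_data G av ae i j" if "i \<in> I" "j \<in> I" "i \<noteq> j" for i j
    using that edge_orbit_count orbit_size_pos[OF finite_quiver automorphism representatives]
    by unfold_locales auto
  have "Q i j = skew_subst (parity av i * parity av j) (gen V_letter) (gen U_letter) (Q j i)"
    if "i \<in> I" "j \<in> I" for i j
    using that quiver_data.Qpoly_swap[OF data[OF that]]
    by (cases "i = j") (simp_all add: Q_def Qpoly_diag_subst)
  moreover have
    "skew_subst (parity av i * parity av j) (- gen U_letter) (gen V_letter) (Q i j) = Q i j"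
    if ij: "i \<in> I" "j \<in> I" and odd_i: "parity av i = 1" for i j
  proof (cases "i = j")
    case True
    then show ?thesis by (simp only: Q_def Qpoly_diag_subst)
  next
    case False
    obtain n where "cartan G av i j = of_int (2 * n)" using odd_rows ij odd_i by blast
    from quiver_data.Qpoly_neg[OF data[OF ij False] odd_i this]
    show ?thesis by (simp only: Q_def)
  qed
  moreover have "Q i j \<in> carrier (skew_ring (parity av i * parity av j))"
    "Q i i = \<zero>\<^bsub>skew_ring (parity av i * parity av i)\<^esub>" for i j
    by (simp_all only: Q_def Qpoly_closed Qpoly_diag)
  ultimately show ?thesis
    unfolding KKT_family_def using quiver_data.exponents_natural[OF data] by blast
qed

end
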